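(* Let $\mathcal{I}$ be an ideal on $\omega$. Then $\mathscr{V}(\mathcal{I})=\overline{c(\mathcal{I}^\star)\cap \ell_\infty}=c(\mathcal{I})\cap \ell_\infty$, where the closure is taken in $\ell_\infty$ with respect to the supremum norm. If, in addition, $\mathcal{I}$ is a $P$-ideal, then also $\mathscr{V}(\mathcal{I})=c+(c_{00}(\mathcal{I})\cap \ell_\infty)$.
   Context: $\omega$ is the set of nonnegative integers. An ideal on $\omega$ is a family $\mathcal{I}\subseteq\mathcal{P}(\omega)$ closed under finite unions and subsets, with $\omega\notin\mathcal{I}$ and containing all finite subsets of $\omega$. An ideal $\mathcal{I}$ is a $P$-ideal if for every sequence $(A_n:n\in\omega)$ in $\mathcal{I}$ there is $A\in\mathcal{I}$ such that $A_n\setminus A$ is finite for all $n$. $\ell_\infty$ is the Banach space of bounded real sequences $(x_n:n\in\omega)$ with the supremum norm and pointwise order; $c$ is the space of convergent real sequences; $\bm{1}_A$ is the characteristic sequence of $A\subseteq\omega$. $\mathrm{SL}(\mathcal{I})$ is the set of linear functionals $f:\ell_\infty\to\mathbf{R}$ such that: (i) $f(x)\ge 0$ whenever $x\ge 0$; (ii) $f(x)=\lim x$ for all $x\in c$; (iii) $f(\bm{1}_A)=0$ for all $A\in\mathcal{I}$. Define $\mathscr{V}(\mathcal{I}):=\{x\in\ell_\infty: f(x)=g(x)\text{ for all } f,g\in\mathrm{SL}(\mathcal{I})\}$. A real sequence $x\in\mathbf{R}^\omega$ is $\mathcal{I}$-convergent to $\eta\in\mathbf{R}$ if $\{n\in\omega:|x_n-\eta|\ge\varepsilon\}\in\mathcal{I}$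 for all $\varepsilon>0$; $c(\mathcal{I})$ is the space of $\mathcal{I}$-convergent sequences. A real sequence $x$ is $\mathcal{I}^\star$-convergent to $\eta\in\mathbf{R}$ if there is $A\in\mathcal{I}$ such that the subsequence $(x_n:n\in\omega\setminus A)$ converges to $\eta$ in the ordinary sense; $c(\mathcal{I}^\star)$ is the space of $\mathcal{I}^\star$-convergent sequences. $c_{00}(\mathcal{I})$ is the set of real sequences $x$ with $\{n\in\omega: x_n\neq 0\}\in\mathcal{I}$. *)

theory Defs
  imports "HOL-Analysis.Analysis" "HOL-Library.Set_Algebras"
begin

definition omega_ideal :: "nat set set \<Rightarrow> bool" where
  "omega_ideal I \<longleftrightarrow>
     (\<forall>A\<in>I. \<forall>B\<in>I. A \<union> B \<in> I) \<and>
     (\<forall>A\<in>I. \<forall>B. B \<subseteq> A \<longrightarrow> B \<in> I) \<and>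
     UNIV \<notin> I \<and>
     (\<forall>F. finite F \<longrightarrow> F \<in> I)"

definition P_ideal :: "nat set set \<Rightarrow> bool" where
  "P_ideal I \<longleftrightarrow> omega_ideal I \<and>
     (\<forall>A :: nat \<Rightarrow> nat set. (\<forall>n. A n \<in> I) \<longrightarrow> (\<exists>B\<in>I. \<forall>n. finite (A n - B)))"

text \<open>Since \<open>nat\<close> carries the discrete topology, the library's Banach space of bounded
  continuous functions from \<open>nat\<close> to \<open>real\<close>, normed by the supremum norm, is the space of
  bounded real sequences.\<close>

type_synonym linf = "nat \<Rightarrow>\<^sub>C real"

lemma bcontfun_nat_eq: "(bcontfun :: (nat \<Rightarrow> real) set) = {x. bounded (range x)}"
  by (auto simp: bcontfun_def)

lemma norm_linf_eq: "norm (x :: linf) = (SUP n. \<bar>x n\<bar>)"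
  by (simp add: norm_bcontfun_def dist_bcontfun_def zero_bcontfun.rep_eq)

text \<open>The intersection of a set of real sequences with the space of bounded sequences,
  as a subset of the latter.\<close>

definition bounded_part :: "(nat \<Rightarrow> real) set \<Rightarrow> linf set" where
  "bounded_part X = {x. apply_bcontfun x \<in> X}"

definition char_seq :: "nat set \<Rightarrow> linf" where
  "char_seq A = Bcontfun (indicator A)"

lemma apply_char_seq [simp]: "apply_bcontfun (char_seq A) n = indicator A n"
proof -
  have "(indicator A :: nat \<Rightarrow> real) \<in> bcontfun"
    by (auto simp: bcontfun_nat_eq bounded_iff indicator_def intro!: exI[of _ 1])
  then show ?thesis
    by (simp add: char_seq_def Bcontfun_inverse)
qed

definition conv_seqs :: "(nat \<Rightarrow> real) set" where
  "conv_seqs = {x. convergent x}"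

lemma conv_seqs_subset_bcontfun: "conv_seqs \<subseteq> bcontfun"
  by (auto simp: conv_seqs_def bcontfun_nat_eq convergent_def intro: convergent_imp_bounded)

definition SL :: "nat set set \<Rightarrow> (linf \<Rightarrow> real) set" where
  "SL I = {f. linear f \<and>
     (\<forall>x. (\<forall>n. 0 \<le> apply_bcontfun x n) \<longrightarrow> 0 \<le> f x) \<and>
     (\<forall>x\<in>bounded_part conv_seqs. f x = lim (apply_bcontfun x)) \<and>
     (\<forall>A\<in>I. f (char_seq A) = 0)}"

definition \<V> :: "nat set set \<Rightarrow> linf set" where
  "\<V> I = {x. \<forall>f\<in>SL I. \<forall>g\<in>SL I. f x = g x}"

definition ideal_converges :: "nat set set \<Rightarrow> (nat \<Rightarrow> real) \<Rightarrow> real \<Rightarrow> bool" where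
  "ideal_converges I x \<eta> \<longleftrightarrow> (\<forall>\<epsilon>>0. {n. \<bar>x n - \<eta>\<bar> \<ge> \<epsilon>} \<in> I)"

definition c_ideal :: "nat set set \<Rightarrow> (nat \<Rightarrow> real) set" where
  "c_ideal I = {x. \<exists>\<eta>. ideal_converges I x \<eta>}"

text \<open>For a set \<open>A\<close> in an ideal in the above sense the complement is infinite, so
  \<open>enumerate (- A)\<close> is its increasing enumeration.\<close>

definition ideal_star_converges :: "nat set set \<Rightarrow> (nat \<Rightarrow> real) \<Rightarrow> real \<Rightarrow> bool" where
  "ideal_star_converges I x \<eta> \<longleftrightarrow> (\<exists>A\<in>I. (\<lambda>k. x (enumerate (- A) k)) \<longlonglongrightarrow> \<eta>)"

definition c_ideal_star :: "nat set set \<Rightarrow> (nat \<Rightarrow> real) set" where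
  "c_ideal_star I = {x. \<exists>\<eta>. ideal_star_converges I x \<eta>}"

definition c00_ideal :: "nat set set \<Rightarrow> (nat \<Rightarrow> real) set" where
  "c00_ideal I = {x. {n. x n \<noteq> 0} \<in> I}"

end

theory Submission
  imports Defs
begin

text \<open>
  A functional in \<open>SL I\<close> is monotone, normalised and blind to changes on members of \<open>I\<close>, so it
  sends a bounded sequence that is \<open>I\<close>-convergent to \<open>\<eta>\<close> to the value \<open>\<eta>\<close>: up to \<open>\<epsilon>\<close> the
  sequence differs from \<open>\<eta>\<close> only on a member of \<open>I\<close> (\<open>SL_eq_ideal_limit\<close>). Hence bounded
  \<open>I\<close>-convergent sequences lie in \<open>\<V> I\<close>.

  The converse needs many elements of \<open>SL I\<close>. The evaluations \<open>x \<mapsto> x n\<close> are positive linear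
  functionals that all lie in the product of the intervals \<open>[-\<parallel>x\<parallel>, \<parallel>x\<parallel>]\<close>, which is compact
  by Tychonoff's theorem. Any proper filter on \<open>nat\<close> that contains the complements of the members
  of \<open>I\<close> therefore yields a cluster point of the evaluations, and every cluster point belongs to
  \<open>SL I\<close> (\<open>SL_cluster_point\<close>). If \<open>S \<notin> I\<close>, the filter may in addition be chosen to contain \<open>S\<close>,
  so that the functional obtained only sees the values on \<open>S\<close> (\<open>SL_concentrated\<close>). If all
  functionals in \<open>SL I\<close> take the value \<open>\<eta>\<close> at \<open>x\<close>, then neither \<open>{n. x n \<ge> \<eta> + \<epsilon>}\<close> nor
  \<open>{n. x n \<le> \<eta> - \<epsilon>}\<close> can be such an \<open>S\<close>, which says that \<open>x\<close> is \<open>I\<close>-convergent to \<open>\<eta>\<close>.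

  Functionals in \<open>SL I\<close> are bounded, so \<open>\<V> I\<close> is closed; and replacing the terms of an
  \<open>I\<close>-convergent sequence that are \<open>\<epsilon>\<close>-close to the limit by the limit itself gives an
  \<open>I\<^sup>\<star>\<close>-convergent sequence at distance at most \<open>\<epsilon>\<close>. This gives the closure formula. For a
  P-ideal, a pseudo-union in \<open>I\<close> of the sets \<open>{n. \<bar>x n - \<eta>\<bar> \<ge> 1 / (k + 1)}\<close> carries all of the
  deviation of \<open>x\<close> from ordinary convergence, and cutting \<open>x\<close> along it gives the decomposition.
\<close>

section \<open>Ideals and ideal convergence\<close>

lemma omega_idealD:
  assumes "omega_ideal I"
  shows "A \<in> I \<Longrightarrow> B \<in> I \<Longrightarrow> A \<union> B \<in> I" "A \<in> I \<Longrightarrow> B \<subseteq> A \<Longrightarrow> B \<in> I"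
    "UNIV \<notin> I" "finite A \<Longrightarrow> A \<in> I"
  using assms unfolding omega_ideal_def by blast+

lemma infinite_Compl_of_ideal:
  assumes "omega_ideal I" "A \<in> I"
  shows "infinite (- A)"
  using omega_idealD[OF assms(1)] assms(2) by (metis Compl_partition)

lemma finite_outside_of_LIMSEQ_enumerate:
  fixes x :: "nat \<Rightarrow> real"
  assumes lim: "(\<lambda>k. x (enumerate S k)) \<longlonglongrightarrow> \<eta>" and S: "infinite S" and "0 < \<epsilon>"
  shows "finite {n\<in>S. \<epsilon> \<le> \<bar>x n - \<eta>\<bar>}"
proof -
  obtain N where N: "\<And>k. k \<ge> N \<Longrightarrow> \<bar>x (enumerate S k) - \<eta>\<bar> < \<epsilon>"
    using LIMSEQ_D[OF lim \<open>0 < \<epsilon>\<close>] by auto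
  have "{n\<in>S. \<epsilon> \<le> \<bar>x n - \<eta>\<bar>} \<subseteq> enumerate S ` {..<N}"
  proof
    fix n assume n: "n \<in> {n\<in>S. \<epsilon> \<le> \<bar>x n - \<eta>\<bar>}"
    then obtain k where k: "n = enumerate S k"
      using enumerate_Ex[OF S, of n] by force
    with n N[of k] have "k < N" by (metis (no_types, lifting) linorder_not_less mem_Collect_eq)
    with k show "n \<in> enumerate S ` {..<N}" by blast
  qed
  then show ?thesis by (rule finite_subset) simp
qed

lemma c_ideal_star_subset_c_ideal:
  assumes I: "omega_ideal I"
  shows "c_ideal_star I \<subseteq> c_ideal I"
proof
  fix x assume "x \<in> c_ideal_star I"
  then obtain \<eta> A where A: "A \<in> I" and lim: "(\<lambda>k. x (enumerate (- A) k)) \<longlonglongrightarrow> \<eta>"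
    unfolding c_ideal_star_def ideal_star_converges_def by blast
  have "{n. \<epsilon> \<le> \<bar>x n - \<eta>\<bar>} \<in> I" if "0 < \<epsilon>" for \<epsilon>
  proof (rule omega_idealD(2)[OF I])
    show "A \<union> {n \<in> - A. \<epsilon> \<le> \<bar>x n - \<eta>\<bar>} \<in> I"
      using A omega_idealD(4)[OF I
        finite_outside_of_LIMSEQ_enumerate[OF lim infinite_Compl_of_ideal[OF I A] that]]
      by (rule omega_idealD(1)[OF I])
  qed auto
  then show "x \<in> c_ideal I"
    unfolding c_ideal_def ideal_converges_def by blast
qed

lemma convergent_plus_c00_in_c_ideal:
  assumes I: "omega_ideal I" and u: "u \<in> conv_seqs" and v: "v \<in> c00_ideal I"
  shows "(\<lambda>n. u n + v n) \<in> c_ideal I"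
proof -
  obtain \<eta> where \<eta>: "u \<longlonglongrightarrow> \<eta>"
    using u unfolding conv_seqs_def convergent_def by blast
  have "{n. \<epsilon> \<le> \<bar>u n + v n - \<eta>\<bar>} \<in> I" if "0 < \<epsilon>" for \<epsilon>
  proof -
    obtain N where N: "\<And>n. n \<ge> N \<Longrightarrow> \<bar>u n - \<eta>\<bar> < \<epsilon>"
      using LIMSEQ_D[OF \<eta> \<open>0 < \<epsilon>\<close>] by auto
    have "{n. v n \<noteq> 0} \<union> {..<N} \<in> I"
      using v omega_idealD(1,4)[OF I] unfolding c00_ideal_def by simp
    moreover have "{n. \<epsilon> \<le> \<bar>u n + v n - \<eta>\<bar>} \<subseteq> {n. v n \<noteq> 0} \<union> {..<N}"
    proof
      fix n assume "n \<in> {n. \<epsilon> \<le> \<bar>u n + v n - \<eta>\<bar>}"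
      then show "n \<in> {n. v n \<noteq> 0} \<union> {..<N}"
        using N[of n] by (cases "v n = 0"; cases "n < N") auto
    qed
    ultimately show ?thesis
      by (rule omega_idealD(2)[OF I])
  qed
  then show ?thesis
    unfolding c_ideal_def ideal_converges_def by blast
qed

section \<open>Functionals in \<open>SL I\<close>\<close>

lemma abs_apply_le_norm: "\<bar>apply_bcontfun x n\<bar> \<le> norm x" for x :: linf
  using norm_bounded[of x n] by simp

lemma SL_linear: "f \<in> SL I \<Longrightarrow> linear f"
  by (simp add: SL_def)

lemma SL_char_seq: "f \<in> SL I \<Longrightarrow> A \<in> I \<Longrightarrow> f (char_seq A) = 0"
  by (simp add: SL_def)

lemma SL_const: "f \<in> SL I \<Longrightarrow> f (const_bcontfun c) = c"
  unfolding SL_def bounded_part_def conv_seqs_def by (simp add: convergent_const)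

lemma SL_mono:
  assumes f: "f \<in> SL I" and le: "\<And>n. apply_bcontfun x n \<le> apply_bcontfun y n"
  shows "f x \<le> f y"
proof -
  have "0 \<le> f (y - x)"
    using f le unfolding SL_def by simp
  then show ?thesis
    by (simp add: linear_diff[OF SL_linear[OF f]])
qed

lemma SL_abs_le_norm:
  assumes f: "f \<in> SL I"
  shows "\<bar>f x\<bar> \<le> norm x"
proof -
  have "f x \<le> f (const_bcontfun (norm x))" "f (const_bcontfun (- norm x)) \<le> f x"
    using abs_apply_le_norm[of x] by (auto intro!: SL_mono[OF f] simp: abs_le_iff minus_le_iff)
  then show ?thesis
    by (simp add: SL_const[OF f])
qed

lemma closed_\<V>: "closed (\<V> I)"
proof -
  have cont: "continuous_on UNIV f" if f: "f \<in> SL I" for f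
  proof (rule linear_continuous_on)
    show "bounded_linear f"
      using SL_linear[OF f] SL_abs_le_norm[OF f]
      by (intro bounded_linear_intro[where K = 1]) (auto simp: linear_add linear_cmul)
  qed
  have "\<V> I = (\<Inter>f\<in>SL I. \<Inter>g\<in>SL I. {x. f x = g x})"
    unfolding \<V>_def by blast
  then show ?thesis
    by (auto intro!: closed_INT closed_Collect_eq cont)
qed

text \<open>The sequence lies below \<open>\<eta> + \<epsilon>\<close> except on a member of the ideal, where adding a large
  multiple of its characteristic sequence restores the bound at no cost to \<open>f\<close>.\<close>

lemma SL_le_ideal_limit:
  assumes f: "f \<in> SL I" and x: "ideal_converges I (apply_bcontfun x) \<eta>"
  shows "f x \<le> \<eta>"
proof (rule field_le_epsilon)
  fix \<epsilon> :: real assume "0 < \<epsilon>"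
  define A where "A = {n. \<epsilon> \<le> \<bar>apply_bcontfun x n - \<eta>\<bar>}"
  have A: "A \<in> I"
    using x \<open>0 < \<epsilon>\<close> unfolding A_def ideal_converges_def by blast
  define M where "M = norm x + \<bar>\<eta>\<bar>"
  have "f x \<le> f (const_bcontfun (\<eta> + \<epsilon>) + M *\<^sub>R char_seq A)"
  proof (rule SL_mono[OF f])
    fix n
    show "apply_bcontfun x n \<le> apply_bcontfun (const_bcontfun (\<eta> + \<epsilon>) + M *\<^sub>R char_seq A) n"
      using abs_apply_le_norm[of x n] \<open>0 < \<epsilon>\<close>
      by (auto simp: A_def M_def indicator_def)
  qed
  also have "\<dots> = \<eta> + \<epsilon>"
    by (simp only: linear_add[OF SL_linear[OF f]] linear_cmul[OF SL_linear[OF f]]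
        SL_const[OF f] SL_char_seq[OF f A]) simp
  finally show "f x \<le> \<eta> + \<epsilon>" .
qed

lemma SL_eq_ideal_limit:
  assumes f: "f \<in> SL I" and x: "ideal_converges I (apply_bcontfun x) \<eta>"
  shows "f x = \<eta>"
proof (rule antisym)
  show "f x \<le> \<eta>"
    using assms by (rule SL_le_ideal_limit)
  have "\<bar>- a - - \<eta>\<bar> = \<bar>a - \<eta>\<bar>" for a :: real
    by simp
  then have "ideal_converges I (apply_bcontfun (- x)) (- \<eta>)"
    using x unfolding ideal_converges_def by simp
  from SL_le_ideal_limit[OF f this] show "\<eta> \<le> f x"
    by (simp add: linear_neg[OF SL_linear[OF f]])
qed

section \<open>Cluster points of evaluation functionals\<close>

definition dual_filter :: "nat set set \<Rightarrow> nat filter" where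
  "dual_filter I = Abs_filter (\<lambda>P. {n. \<not> P n} \<in> I)"

lemma eventually_dual_filter:
  assumes I: "omega_ideal I"
  shows "eventually P (dual_filter I) \<longleftrightarrow> {n. \<not> P n} \<in> I"
  unfolding dual_filter_def
proof (rule eventually_Abs_filter, rule is_filter.intro)
  show "{n. \<not> True} \<in> I"
    using omega_idealD(4)[OF I] by simp
next
  fix P Q assume "{n. \<not> P n} \<in> I" "{n. \<not> Q n} \<in> I"
  then show "{n. \<not> (P n \<and> Q n)} \<in> I"
    by (auto intro: omega_idealD(2)[OF I omega_idealD(1)[OF I]])
next
  fix P Q assume "\<forall>n. P n \<longrightarrow> Q n" "{n. \<not> P n} \<in> I"
  then show "{n. \<not> Q n} \<in> I"
    by (auto intro: omega_idealD(2)[OF I])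
qed

lemma dual_filter_le_sequentially:
  assumes I: "omega_ideal I"
  shows "dual_filter I \<le> sequentially"
  unfolding le_filter_def eventually_sequentially
proof (intro allI impI)
  fix P :: "nat \<Rightarrow> bool" assume "\<exists>N. \<forall>n\<ge>N. P n"
  then obtain N where N: "\<And>n. n \<ge> N \<Longrightarrow> P n"
    by blast
  have "n < N" if "\<not> P n" for n
    using that N[of n] by (meson linorder_not_less)
  then have "{n. \<not> P n} \<subseteq> {..<N}"
    by auto
  then show "eventually P (dual_filter I)"
    unfolding eventually_dual_filter[OF I] by (metis finite_lessThan finite_subset omega_idealD(4)[OF I])
qed

text \<open>Being linear, positive, equal to the limit on convergent sequences and zero on characteristic
  sequences of members of \<open>I\<close> are all closed conditions in the topology of pointwise convergence,
  and along the filter the evaluations satisfy them, eventually or in the limit. So a cluster point,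
  which exists by compactness, inherits them; pointwise lower bounds pass to it in the same way.
  Here "in the limit" refers to the filter \<open>G\<close> below, which refines the image of \<open>F\<close> and
  converges pointwise to the cluster point.\<close>

lemma SL_cluster_point:
  assumes I: "omega_ideal I" and F: "F \<le> dual_filter I" "F \<noteq> bot"
  obtains f where "f \<in> SL I"
    "\<And>x t. eventually (\<lambda>n. t \<le> apply_bcontfun x n) F \<Longrightarrow> t \<le> f x"
proof -
  define ev where "ev = (\<lambda>n (x :: linf). apply_bcontfun x n)"
  define K where "K = PiE UNIV (\<lambda>x :: linf. {- norm x .. norm x})"
  have "compactin (product_topology (\<lambda>_. euclidean) UNIV) K"
    unfolding K_def compactin_PiE by simp
  then have "compact K"
    by (simp add: euclidean_product_topology)
  moreover have "ev n \<in> K" for n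
    using abs_apply_le_norm[of _ n]
    by (auto simp: K_def ev_def PiE_iff abs_le_iff minus_le_iff)
  then have "eventually (\<lambda>\<phi>. \<phi> \<in> K) (filtermap ev F)"
    by (simp add: eventually_filtermap)
  moreover have "filtermap ev F \<noteq> bot"
    using F(2) by (simp add: filtermap_bot_iff)
  ultimately obtain f where f: "inf (nhds f) (filtermap ev F) \<noteq> bot"
    unfolding compact_filter by blast
  define G where "G = inf (nhds f) (filtermap ev F)"
  have G: "G \<noteq> bot" and G_le: "G \<le> filtermap ev F"
    using f unfolding G_def by auto
  have lim_f: "((\<lambda>\<phi>. \<phi> x) \<longlongrightarrow> f x) G" for x
  proof (rule tendsto_mono)
    show "G \<le> nhds f"
      unfolding G_def by simp
    have "((\<lambda>\<phi>. \<phi> x) \<longlongrightarrow> f x) (at f)"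
      using continuous_on_product_coordinates[of x] unfolding continuous_on_def by blast
    then show "((\<lambda>\<phi>. \<phi> x) \<longlongrightarrow> f x) (nhds f)"
      by (rule tendsto_at_iff_tendsto_nhds[of "\<lambda>\<phi>. \<phi> x" f, THEN iffD1])
  qed
  have ev_G: "eventually P G" if "eventually (\<lambda>n. P (ev n)) F" for P
    using that G_le by (simp add: filter_leD eventually_filtermap)
  have lower: "t \<le> f x" if "eventually (\<lambda>n. t \<le> apply_bcontfun x n) F" for x t
    using that by (intro tendsto_lowerbound[OF lim_f _ G] ev_G) (simp add: ev_def)
  have upper: "f x \<le> t" if "eventually (\<lambda>n. apply_bcontfun x n \<le> t) F" for x t
    using that by (intro tendsto_upperbound[OF lim_f _ G] ev_G) (simp add: ev_def)
  have lin: "linear f"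
  proof (rule linearI)
    fix x y :: linf and r :: real
    have "((\<lambda>\<phi>. \<phi> (x + y)) \<longlongrightarrow> f x + f y) G"
      by (rule Lim_transform_eventually[OF tendsto_add[OF lim_f lim_f]], rule ev_G)
        (simp add: ev_def)
    then show "f (x + y) = f x + f y"
      by (rule tendsto_unique[OF G lim_f])
    have "((\<lambda>\<phi>. \<phi> (r *\<^sub>R x)) \<longlongrightarrow> r *\<^sub>R f x) G"
      by (rule Lim_transform_eventually[OF tendsto_scaleR[OF tendsto_const lim_f]], rule ev_G)
        (simp add: ev_def)
    then show "f (r *\<^sub>R x) = r *\<^sub>R f x"
      by (rule tendsto_unique[OF G lim_f])
  qed
  have F_seq: "F \<le> sequentially"
    using F(1) dual_filter_le_sequentially[OF I] by (rule order_trans)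
  have "f x = lim (apply_bcontfun x)" if "x \<in> bounded_part conv_seqs" for x
  proof -
    have "(apply_bcontfun x \<longlongrightarrow> lim (apply_bcontfun x)) F"
      using that tendsto_mono[OF F_seq]
      by (simp add: bounded_part_def conv_seqs_def convergent_LIMSEQ_iff)
    then have "((\<lambda>\<phi>. \<phi> x) \<longlongrightarrow> lim (apply_bcontfun x)) (filtermap ev F)"
      by (simp add: filterlim_filtermap ev_def)
    then have "((\<lambda>\<phi>. \<phi> x) \<longlongrightarrow> lim (apply_bcontfun x)) G"
      by (rule tendsto_mono[OF G_le])
    then show ?thesis
      by (rule tendsto_unique[OF G lim_f])
  qed
  moreover have "f (char_seq A) = 0" if "A \<in> I" for A
  proof -
    have "eventually (\<lambda>n. n \<notin> A) F"
      using that by (intro filter_leD[OF F(1)]) (simp add: eventually_dual_filter[OF I])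
    then have "eventually (\<lambda>n. apply_bcontfun (char_seq A) n = 0) F"
      by eventually_elim simp
    then show ?thesis
      by (intro antisym lower upper) (auto elim: eventually_mono)
  qed
  moreover have "0 \<le> f x" if "\<forall>n. 0 \<le> apply_bcontfun x n" for x
    using that by (intro lower) simp
  ultimately have "f \<in> SL I"
    unfolding SL_def using lin by blast
  with lower show ?thesis
    using that by blast
qed

text \<open>That \<open>S\<close> is not in \<open>I\<close> says exactly that adding \<open>S\<close> to the dual filter keeps it proper.\<close>

lemma SL_concentrated:
  assumes I: "omega_ideal I" and S: "S \<notin> I"
  obtains f where "f \<in> SL I" "\<And>x t. \<forall>n\<in>S. t \<le> apply_bcontfun x n \<Longrightarrow> t \<le> f x"
proof -
  define F where "F = inf (dual_filter I) (principal S)"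
  have "F \<noteq> bot"
    using S by (simp add: F_def trivial_limit_def eventually_inf_principal eventually_dual_filter[OF I])
  moreover have "F \<le> dual_filter I"
    by (simp add: F_def)
  ultimately obtain f where f: "f \<in> SL I"
    "\<And>x t. eventually (\<lambda>n. t \<le> apply_bcontfun x n) F \<Longrightarrow> t \<le> f x"
    using SL_cluster_point[OF I] by blast
  show ?thesis
    by (rule that[OF f(1)], rule f(2)) (simp add: F_def eventually_inf_principal)
qed

section \<open>The three descriptions of \<open>\<V> I\<close>\<close>

lemma \<V>_eq_c_ideal:
  assumes I: "omega_ideal I"
  shows "\<V> I = bounded_part (c_ideal I)"
proof (intro subset_antisym subsetI)
  fix x assume "x \<in> bounded_part (c_ideal I)"
  then obtain \<eta> where "ideal_converges I (apply_bcontfun x) \<eta>"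
    unfolding bounded_part_def c_ideal_def by blast
  then show "x \<in> \<V> I"
    unfolding \<V>_def by (auto dest: SL_eq_ideal_limit)
next
  fix x assume x: "x \<in> \<V> I"
  obtain f\<^sub>0 where f\<^sub>0: "f\<^sub>0 \<in> SL I"
    using SL_concentrated[OF I omega_idealD(3)[OF I]] by blast
  define \<eta> where "\<eta> = f\<^sub>0 x"
  have \<eta>: "f x = \<eta>" if "f \<in> SL I" for f
    using x f\<^sub>0 that unfolding \<V>_def \<eta>_def by blast
  have "{n. \<epsilon> \<le> \<bar>apply_bcontfun x n - \<eta>\<bar>} \<in> I" if "0 < \<epsilon>" for \<epsilon>
  proof -
    have "{n. \<eta> + \<epsilon> \<le> apply_bcontfun x n} \<in> I"
    proof (rule ccontr)
      assume "{n. \<eta> + \<epsilon> \<le> apply_bcontfun x n} \<notin> I"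
      then obtain f where f: "f \<in> SL I"
        and lower: "\<And>y t. \<forall>n\<in>{n. \<eta> + \<epsilon> \<le> apply_bcontfun x n}. t \<le> apply_bcontfun y n \<Longrightarrow> t \<le> f y"
        by (rule SL_concentrated[OF I]) blast
      have "\<eta> + \<epsilon> \<le> f x"
        by (rule lower) simp
      then show False
        using \<eta>[OF f] \<open>0 < \<epsilon>\<close> by simp
    qed
    moreover have "{n. apply_bcontfun x n \<le> \<eta> - \<epsilon>} \<in> I"
    proof (rule ccontr)
      assume "{n. apply_bcontfun x n \<le> \<eta> - \<epsilon>} \<notin> I"
      then obtain f where f: "f \<in> SL I"
        and lower: "\<And>y t. \<forall>n\<in>{n. apply_bcontfun x n \<le> \<eta> - \<epsilon>}. t \<le> apply_bcontfun y n \<Longrightarrow> t \<le> f y"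
        by (rule SL_concentrated[OF I]) blast
      have "\<epsilon> - \<eta> \<le> f (- x)"
        by (rule lower) simp
      then show False
        using \<eta>[OF f] \<open>0 < \<epsilon>\<close> by (simp add: linear_neg[OF SL_linear[OF f]])
    qed
    ultimately show ?thesis
      by (rule omega_idealD(2)[OF I omega_idealD(1)[OF I]]) auto
  qed
  then show "x \<in> bounded_part (c_ideal I)"
    unfolding bounded_part_def c_ideal_def ideal_converges_def by blast
qed

lemma bounded_c_ideal_subset_closure:
  assumes I: "omega_ideal I"
  shows "bounded_part (c_ideal I) \<subseteq> closure (bounded_part (c_ideal_star I))"
proof
  fix x assume "x \<in> bounded_part (c_ideal I)"
  then obtain \<eta> where x: "ideal_converges I (apply_bcontfun x) \<eta>"
    unfolding bounded_part_def c_ideal_def by blast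
  have "\<exists>y\<in>bounded_part (c_ideal_star I). dist y x \<le> \<epsilon>" if "0 < \<epsilon>" for \<epsilon>
  proof -
    define A where "A = {n. \<epsilon> \<le> \<bar>apply_bcontfun x n - \<eta>\<bar>}"
    have A: "A \<in> I"
      using x \<open>0 < \<epsilon>\<close> unfolding A_def ideal_converges_def by blast
    define y where "y n = (if n \<in> A then apply_bcontfun x n else \<eta>)" for n
    have "\<bar>y n\<bar> \<le> max (norm x) \<bar>\<eta>\<bar>" for n
      using abs_apply_le_norm[of x n] by (auto simp: y_def)
    then have "y \<in> bcontfun"
      by (intro bcontfun_normI) auto
    then have y: "apply_bcontfun (Bcontfun y) = y"
      by (simp add: Bcontfun_inverse)
    show ?thesis
    proof
      show "dist (Bcontfun y) x \<le> \<epsilon>"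
        using \<open>0 < \<epsilon>\<close> by (intro dist_bound) (auto simp: y y_def A_def dist_real_def abs_minus_commute)
      have "y (enumerate (- A) k) = \<eta>" for k
        using enumerate_in_set[OF infinite_Compl_of_ideal[OF I A], of k] by (simp add: y_def)
      then have "(\<lambda>k. y (enumerate (- A) k)) \<longlonglongrightarrow> \<eta>"
        by simp
      with A show "Bcontfun y \<in> bounded_part (c_ideal_star I)"
        unfolding bounded_part_def c_ideal_star_def ideal_star_converges_def y mem_Collect_eq
        by blast
    qed
  qed
  then show "x \<in> closure (bounded_part (c_ideal_star I))"
    by (meson closure_approachable_le)
qed

text \<open>Only here the P-property enters: in general there is no single member of \<open>I\<close> off which an
  \<open>I\<close>-convergent sequence converges, but for a P-ideal there is, and setting the sequence to its
  limit on that member makes it convergent.\<close>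

lemma P_ideal_decomposition:
  assumes P: "P_ideal I" and x: "x \<in> bounded_part (c_ideal I)"
  shows "x \<in> bounded_part conv_seqs + bounded_part (c00_ideal I)"
proof -
  have I: "omega_ideal I"
    using P unfolding P_ideal_def by blast
  obtain \<eta> where \<eta>: "ideal_converges I (apply_bcontfun x) \<eta>"
    using x unfolding bounded_part_def c_ideal_def by blast
  define A where "A k = {n. 1 / Suc k \<le> \<bar>apply_bcontfun x n - \<eta>\<bar>}" for k
  have "\<forall>k. A k \<in> I"
    using \<eta> unfolding A_def ideal_converges_def by simp
  then obtain B where B: "B \<in> I" "\<And>k. finite (A k - B)"
    using P unfolding P_ideal_def by blast
  define u where "u n = (if n \<in> B then \<eta> else apply_bcontfun x n)" for n
  have "\<bar>u n\<bar> \<le> max (norm x) \<bar>\<eta>\<bar>" for n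
    using abs_apply_le_norm[of x n] by (auto simp: u_def)
  then have "u \<in> bcontfun"
    by (intro bcontfun_normI) auto
  then have u: "apply_bcontfun (Bcontfun u) = u"
    by (simp add: Bcontfun_inverse)
  have "u \<longlonglongrightarrow> \<eta>"
  proof (rule LIMSEQ_I)
    fix \<epsilon> :: real assume "0 < \<epsilon>"
    then obtain k where k: "1 / Suc k < \<epsilon>"
      using nat_approx_posE by blast
    obtain N where N: "A k - B \<subseteq> {..<N}"
      using finite_nat_bounded[OF B(2)] by blast
    have "norm (u n - \<eta>) < \<epsilon>" if "n \<ge> N" for n
    proof (cases "n \<in> B")
      case True
      then show ?thesis using \<open>0 < \<epsilon>\<close> by (simp add: u_def)
    next
      case False
      then have "n \<notin> A k" using N that by auto
      with False k show ?thesis by (simp add: u_def A_def)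
    qed
    then show "\<exists>N. \<forall>n\<ge>N. norm (u n - \<eta>) < \<epsilon>" by blast
  qed
  then have "Bcontfun u \<in> bounded_part conv_seqs"
    unfolding bounded_part_def conv_seqs_def by (auto simp: u convergent_def)
  moreover have "{n. apply_bcontfun (x - Bcontfun u) n \<noteq> 0} \<subseteq> B"
    by (auto simp: u u_def)
  then have "x - Bcontfun u \<in> bounded_part (c00_ideal I)"
    using omega_idealD(2)[OF I B(1)] unfolding bounded_part_def c00_ideal_def by blast
  ultimately have "Bcontfun u + (x - Bcontfun u) \<in> bounded_part conv_seqs + bounded_part (c00_ideal I)"
    by (rule set_plus_intro)
  then show ?thesis by simp
qed

theorem theorem1p3:
  fixes I :: "nat set set"
  assumes "omega_ideal I"
  shows "\<V> I = closure (bounded_part (c_ideal_star I)) \<and>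
    closure (bounded_part (c_ideal_star I)) = bounded_part (c_ideal I) \<and>
    (P_ideal I \<longrightarrow> \<V> I = bounded_part conv_seqs + bounded_part (c00_ideal I))"
proof -
  note V = \<V>_eq_c_ideal[OF assms]
  have "closure (bounded_part (c_ideal_star I)) \<subseteq> bounded_part (c_ideal I)"
  proof (rule closure_minimal)
    show "bounded_part (c_ideal_star I) \<subseteq> bounded_part (c_ideal I)"
      using c_ideal_star_subset_c_ideal[OF assms] unfolding bounded_part_def by blast
    show "closed (bounded_part (c_ideal I))"
      using closed_\<V>[of I] V by simp
  qed
  then have closure: "closure (bounded_part (c_ideal_star I)) = bounded_part (c_ideal I)"
    using bounded_c_ideal_subset_closure[OF assms] by (rule subset_antisym)
  have "bounded_part conv_seqs + bounded_part (c00_ideal I) \<subseteq> bounded_part (c_ideal I)"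
  proof
    fix x assume "x \<in> bounded_part conv_seqs + bounded_part (c00_ideal I)"
    then obtain u v where "x = u + v" "u \<in> bounded_part conv_seqs" "v \<in> bounded_part (c00_ideal I)"
      by (rule set_plus_elim)
    then show "x \<in> bounded_part (c_ideal I)"
      using convergent_plus_c00_in_c_ideal[OF assms] unfolding bounded_part_def
      by (simp add: plus_bcontfun.rep_eq)
  qed
  then have "bounded_part (c_ideal I) = bounded_part conv_seqs + bounded_part (c00_ideal I)"
    if "P_ideal I"
    using P_ideal_decomposition[OF that] by blast
  with V closure show ?thesis by simp
qed

end
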